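(* Let $n \ge 3$, let $G = C_n$ be the cycle of order $n$, and let $f: V(G_1)\to V(G_2)$ be any function with $|f(V(G_1))| = s$, where $1 < s < n$. Then $2 \le \dim(C(C_n, f)) \le 2(n-1)-s$.
   Context: For a connected graph $H$, a set $S \subseteq V(H)$ is a resolving set if for every two distinct vertices $x,y$ of $H$ there is $s \in S$ with $d_H(x,s) \neq d_H(y,s)$; the metric dimension $\dim(H)$ is the minimum cardinality of a resolving set of $H$. Given a graph $G$, let $G_1$ and $G_2$ be disjoint copies of $G$ and let $f: V(G_1)\to V(G_2)$ be a function. The functigraph $C(G,f)$ is the graph with vertex set $V(G_1)\cup V(G_2)$ and edge set $E(G_1)\cup E(G_2)\cup\{uv \mid u \in V(G_1),\ v=f(u)\}$. *)

theory Defs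
  imports "Graph_Theory.Graph_Theory"
begin

text \<open>
  A simple graph is a \<^typ>\<open>'a pair_pre_digraph\<close> in the sense of the locale \<^locale>\<open>pair_graph\<close>:
  finite, loop-free, and every edge \<open>uv\<close> is present as the two arcs \<open>(u, v)\<close> and \<open>(v, u)\<close>.
\<close>

text \<open>
  \<open>wf_digraph.\<mu>\<close> is the infimum of the costs of all walks between two vertices; with unit
  arc costs this is the minimum number of edges, and it is finite between connected vertices.
\<close>

definition graph_dist :: "'a pair_pre_digraph \<Rightarrow> 'a \<Rightarrow> 'a \<Rightarrow> ereal" where
  "graph_dist H u v = wf_digraph.\<mu> (with_proj H) (\<lambda>_. 1) u v"

definition resolving_set :: "'a pair_pre_digraph \<Rightarrow> 'a set \<Rightarrow> bool" where
  "resolving_set H S \<longleftrightarrow> S \<subseteq> pverts H \<and>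
     (\<forall>x \<in> pverts H. \<forall>y \<in> pverts H. x \<noteq> y \<longrightarrow>
        (\<exists>s \<in> S. graph_dist H x s \<noteq> graph_dist H y s))"

text \<open>
  In a finite connected graph the whole vertex set is resolving, so the minimum exists.
\<close>

definition metric_dim :: "'a pair_pre_digraph \<Rightarrow> nat" where
  "metric_dim H = (LEAST k. \<exists>S. finite S \<and> resolving_set H S \<and> card S = k)"

text \<open>The two disjoint copies of \<open>G\<close> are the left and right summands of \<^typ>\<open>'a + 'a\<close>.\<close>

definition functigraph :: "'a pair_pre_digraph \<Rightarrow> ('a \<Rightarrow> 'a) \<Rightarrow> ('a + 'a) pair_pre_digraph" where
  "functigraph G f = \<lparr>
     pverts = Inl ` pverts G \<union> Inr ` pverts G,
     parcs = {(Inl u, Inl v) | u v. (u, v) \<in> parcs G}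
           \<union> {(Inr u, Inr v) | u v. (u, v) \<in> parcs G}
           \<union> {(Inl u, Inr (f u)) | u. u \<in> pverts G}
           \<union> {(Inr (f u), Inl u) | u. u \<in> pverts G} \<rparr>"

text \<open>A simple graph only for \<open>n \<ge> 3\<close>: loop for \<open>n = 1\<close>, single edge for \<open>n = 2\<close>.\<close>

definition cycle_graph :: "nat \<Rightarrow> nat pair_pre_digraph" where
  "cycle_graph n = \<lparr>
     pverts = {..<n},
     parcs = {(i, j). i < n \<and> j < n \<and> (j = (i + 1) mod n \<or> i = (j + 1) mod n)} \<rparr>"

lemma pair_graph_cycle_graph:
  assumes "n \<ge> 3"
  shows "pair_graph (cycle_graph n)"
proof
  show "finite (parcs (cycle_graph n))"
    by (rule finite_subset[of _ "{..<n} \<times> {..<n}"]) (auto simp: cycle_graph_def)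
  show "fst e \<noteq> snd e" if "e \<in> parcs (cycle_graph n)" for e
    using that assms by (auto simp: cycle_graph_def mod_Suc split: if_splits)
qed (auto simp: cycle_graph_def symmetric_def sym_def)

lemma pair_graph_functigraph:
  assumes "pair_graph G" and f: "f ` pverts G \<subseteq> pverts G"
  shows "pair_graph (functigraph G f)"
proof -
  interpret pair_graph G by fact
  have symG: "(v, u) \<in> parcs G" if "(u, v) \<in> parcs G" for u v
    using pair_sym_arcs that by (auto simp: symmetric_def sym_def)
  show ?thesis
  proof
    show "finite (parcs (functigraph G f))"
    proof (rule finite_subset)
      show "parcs (functigraph G f) \<subseteq> (Inl ` pverts G \<union> Inr ` pverts G) \<times> (Inl ` pverts G \<union> Inr ` pverts G)"
        using f by (auto simp: functigraph_def dest: in_arcsD1 in_arcsD2)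
    qed (use pair_finite_verts in simp)
    show "finite (pverts (functigraph G f))"
      using pair_finite_verts by (simp add: functigraph_def)
    show "fst e \<noteq> snd e" if "e \<in> parcs (functigraph G f)" for e
      using that pair_no_loops by (fastforce simp: functigraph_def)
    show "symmetric (with_proj (functigraph G f))"
      using symG by (auto simp: functigraph_def symmetric_def sym_def)
    show "fst e \<in> pverts (functigraph G f)" "snd e \<in> pverts (functigraph G f)"
      if "e \<in> parcs (functigraph G f)" for e
      using that f by (auto simp: functigraph_def dest: in_arcsD1 in_arcsD2)
  qed
qed

lemma connected_functigraph_cycle:
  assumes "n \<ge> 3" and f: "f ` {..<n} \<subseteq> {..<n}"
  shows "connected (with_proj (functigraph (cycle_graph n) f))"
proof -
  let ?H = "functigraph (cycle_graph n) f"
  have "pair_graph ?H"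
    using pair_graph_functigraph[OF pair_graph_cycle_graph[OF assms(1)]] f
    by (simp add: cycle_graph_def)
  then interpret pair_graph ?H .
  have step: "i \<rightarrow>\<^sup>*\<^bsub>with_proj ?H\<^esub> j" if "(i, j) \<in> parcs ?H" for i j
    using that reachable_adjI by auto
  have base: "Inr 0 \<rightarrow>\<^sup>*\<^bsub>with_proj ?H\<^esub> Inr k" if "k < n" for k
    using that
  proof (induction k)
    case 0
    then have "Inr 0 \<in> pverts ?H" by (simp add: functigraph_def cycle_graph_def)
    then show ?case by (rule reachable_refl)
  next
    case (Suc k)
    have "(Inr k, Inr (Suc k)) \<in> parcs ?H"
      using Suc.prems by (auto simp: functigraph_def cycle_graph_def)
    with Suc show ?case by (meson Suc_lessD reachable_trans step)
  qed
  have all: "Inr 0 \<rightarrow>\<^sup>*\<^bsub>with_proj ?H\<^esub> x" if "x \<in> pverts ?H" for x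
  proof (cases x)
    case (Inr k)
    with that base show ?thesis by (auto simp: functigraph_def cycle_graph_def)
  next
    case (Inl k)
    with that have k: "k < n" by (auto simp: functigraph_def cycle_graph_def)
    then have "(Inr (f k), Inl k) \<in> parcs ?H" by (auto simp: functigraph_def cycle_graph_def)
    with Inl k f base[of "f k"] show ?thesis by (auto intro: reachable_trans step)
  qed
  have "x \<rightarrow>\<^sup>*\<^bsub>with_proj ?H\<^esub> y" if "x \<in> pverts ?H" "y \<in> pverts ?H" for x y
    using that all symmetric_reachable' reachable_trans by blast
  moreover have "Inr 0 \<in> pverts ?H"
    using assms by (auto simp: functigraph_def cycle_graph_def)
  ultimately show ?thesis
    unfolding connected_def strongly_connected_def
    using reachable_mk_symmetricI by (fastforce simp: mk_symmetric_def)
qed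

end

theory Submission
  imports Defs
begin

text \<open>
  Adjacency alone, that is distances 0, 1 and at least 2, resolves the graph. Choose \<open>p\<close> sharing its
  image with another vertex and \<open>z\<close> outside the image of \<open>f\<close>, and let \<open>S\<close> consist of the first copy
  without \<open>p\<close> and of the non-image vertices of the second copy without \<open>z\<close>; it has
  \<open>(n - 1) + (n - s - 1)\<close> elements. Every image vertex \<open>j\<close> keeps a private neighbour in \<open>S\<close>, a preimage
  other than \<open>p\<close>, so only \<open>p\<close> and some \<open>j\<close> can be confused, and only if the fibre of \<open>j\<close> without \<open>p\<close>
  is exactly the neighbourhood of \<open>p\<close>. On a cycle some choice of \<open>p\<close> avoids this, except for
  \<open>n = 4\<close> with \<open>f\<close> alternating between two values, where a suitable \<open>z\<close> helps.
  The lower bound holds because each vertex has two neighbours, which are equidistant from it.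
\<close>

section \<open>Small distances and resolving by adjacency\<close>

context pair_wf_digraph
begin

lemma graph_dist_refl:
  assumes "u \<in> pverts G"
  shows "graph_dist G u u = 0"
  unfolding graph_dist_def \<mu>_def
proof (rule antisym)
  show "(INF p\<in>{p. awalk u p u}. ereal (awalk_cost (\<lambda>_. 1) p)) \<le> 0"
    using assms by (intro INF_lower2[of "[]"]) (auto simp: awalk_Nil_iff zero_ereal_def)
  show "0 \<le> (INF p\<in>{p. awalk u p u}. ereal (awalk_cost (\<lambda>_. 1) p))"
    by (intro INF_greatest) (auto intro: pos_cost_pos_awalk_cost)
qed

lemma graph_dist_ge_1:
  assumes "u \<noteq> v"
  shows "1 \<le> graph_dist G u v"
  unfolding graph_dist_def \<mu>_def
proof (intro INF_greatest)
  fix p assume "p \<in> {p. awalk u p v}"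
  with assms obtain e es where "p = e # es" "awalk (snd e) es v"
    by (cases p) (auto simp: awalk_Nil_iff awalk_Cons_iff)
  then show "1 \<le> ereal (awalk_cost (\<lambda>_. 1) p)"
    using pos_cost_pos_awalk_cost[of "snd e" es v "\<lambda>_. 1"] by simp
qed

lemma graph_dist_eq_1_iff:
  assumes "u \<noteq> v"
  shows "graph_dist G u v = 1 \<longleftrightarrow> (u, v) \<in> parcs G"
proof
  assume arc: "(u, v) \<in> parcs G"
  then have "awalk u [(u, v)] v"
    by (auto simp: awalk_Nil_iff awalk_Cons_iff dest: in_arcsD2 in_arcsD1)
  then have "graph_dist G u v \<le> 1"
    unfolding graph_dist_def using min_cost_le_walk_cost[of u "[(u, v)]" v "\<lambda>_. 1"]
    by (simp add: one_ereal_def)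
  with graph_dist_ge_1[OF assms] show "graph_dist G u v = 1" by simp
next
  assume dist: "graph_dist G u v = 1"
  show "(u, v) \<in> parcs G"
  proof (rule ccontr)
    assume no_arc: "(u, v) \<notin> parcs G"
    \<comment> \<open>The distance is an infimum, so a uniform bound keeps it away from 1: without
      an arc from \<open>u\<close> to \<open>v\<close>, every walk has at least two arcs.\<close>
    have "2 \<le> graph_dist G u v"
      unfolding graph_dist_def \<mu>_def
    proof (intro INF_greatest)
      fix p assume p: "p \<in> {p. awalk u p v}"
      with assms obtain e es where es: "p = e # es" "e \<in> parcs G" "fst e = u" "awalk (snd e) es v"
        by (cases p) (auto simp: awalk_Nil_iff awalk_Cons_iff)
      with no_arc have "snd e \<noteq> v" by (metis prod.collapse)
      with es obtain e' es' where "es = e' # es'" "awalk (snd e') es' v"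
        by (cases es) (auto simp: awalk_Nil_iff awalk_Cons_iff)
      with es show "2 \<le> ereal (awalk_cost (\<lambda>_. 1) p)"
        using pos_cost_pos_awalk_cost[of "snd e'" es' v "\<lambda>_. 1"] by simp
    qed
    with dist show False by simp
  qed
qed

text \<open>A vertex of \<open>S\<close> separates itself from all others by distance 0, so only
  pairs outside \<open>S\<close> need a witness. It differs from both of them, so adjacency to it
  means distance 1.\<close>

lemma resolving_setI_adjacency:
  assumes "S \<subseteq> pverts G"
    and sep: "\<And>x y. x \<in> pverts G - S \<Longrightarrow> y \<in> pverts G - S \<Longrightarrow> x \<noteq> y \<Longrightarrow>
      \<exists>s\<in>S. (x, s) \<in> parcs G \<longleftrightarrow> (y, s) \<notin> parcs G"
  shows "resolving_set G S"
  unfolding resolving_set_def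
proof (intro conjI ballI impI)
  fix x y assume xy: "x \<in> pverts G" "y \<in> pverts G" "x \<noteq> y"
  show "\<exists>s\<in>S. graph_dist G x s \<noteq> graph_dist G y s"
  proof (cases "x \<in> S \<or> y \<in> S")
    case True
    with xy show ?thesis
      using graph_dist_refl graph_dist_ge_1[of x y] graph_dist_ge_1[of y x] by force
  next
    case False
    with sep[of x y] xy obtain s where s: "s \<in> S" "(x, s) \<in> parcs G \<longleftrightarrow> (y, s) \<notin> parcs G"
      by auto
    with False have "x \<noteq> s" "y \<noteq> s" by auto
    with s show ?thesis by (metis graph_dist_eq_1_iff)
  qed
qed fact

text \<open>A single vertex cannot separate two of its neighbours, both at distance 1.\<close>

lemma two_le_card_resolving_set:
  assumes "pverts G \<noteq> {}" "finite S" "resolving_set G S"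
    and two_nbrs: "\<And>s. s \<in> pverts G \<Longrightarrow>
      \<exists>x y. x \<noteq> s \<and> y \<noteq> s \<and> x \<noteq> y \<and> (x, s) \<in> parcs G \<and> (y, s) \<in> parcs G"
  shows "2 \<le> card S"
proof (rule ccontr)
  assume "\<not> 2 \<le> card S"
  then have "card S = 0 \<or> card S = 1" by linarith
  with \<open>finite S\<close> \<open>pverts G \<noteq> {}\<close> \<open>resolving_set G S\<close>
  obtain s where s: "s \<in> pverts G" "S \<subseteq> {s}"
    unfolding resolving_set_def by (auto simp: card_1_singleton_iff)
  with two_nbrs obtain x y where
    xy: "x \<noteq> s" "y \<noteq> s" "x \<noteq> y" "(x, s) \<in> parcs G" "(y, s) \<in> parcs G"
    by blast
  then have "graph_dist G x s = 1" "graph_dist G y s = 1"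
    by (simp_all add: graph_dist_eq_1_iff)
  then have "graph_dist G x s = graph_dist G y s" by simp
  with xy show False
    using \<open>resolving_set G S\<close> s unfolding resolving_set_def by (blast dest: in_arcsD1)
qed

end

section \<open>Resolving sets of functigraphs\<close>

text \<open>In the first copy, \<open>Inl p\<close> sees the neighbourhood of \<open>p\<close> and
  \<open>Inr j\<close> sees the fibre of \<open>j\<close>. If these agree up to \<open>p\<close>, a
  non-image neighbour of \<open>j\<close> from \<open>fibre\<close> has to tell them apart.\<close>

lemma resolving_set_functigraph:
  assumes "pair_graph G" and f: "f ` pverts G \<subseteq> pverts G"
    and pq: "p \<in> pverts G" "q \<in> pverts G" "p \<noteq> q" "f p = f q"
    and z: "z \<notin> f ` pverts G"
    and fibre: "\<And>j. {u \<in> pverts G. f u = j} - {p} = {u. (p, u) \<in> parcs G} \<Longrightarrow>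
      \<exists>k\<in>pverts G - f ` pverts G - {z}. (j, k) \<in> parcs G"
  shows "resolving_set (functigraph G f)
    (Inl ` (pverts G - {p}) \<union> Inr ` (pverts G - f ` pverts G - {z}))" (is "resolving_set ?H ?S")
proof -
  interpret G: pair_graph G by fact
  interpret H: pair_graph ?H by (rule pair_graph_functigraph) fact+
  define sep where "sep x y \<longleftrightarrow> (\<exists>s\<in>?S. (x, s) \<in> parcs ?H \<longleftrightarrow> (y, s) \<notin> parcs ?H)" for x y
  have LL: "(Inl u, Inl v) \<in> parcs ?H \<longleftrightarrow> (u, v) \<in> parcs G" for u v
    by (auto simp: functigraph_def)
  have RR: "(Inr u, Inr v) \<in> parcs ?H \<longleftrightarrow> (u, v) \<in> parcs G" for u v
    by (auto simp: functigraph_def)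
  have LR: "(Inl u, Inr j) \<in> parcs ?H \<longleftrightarrow> u \<in> pverts G \<and> f u = j" for u j
    by (auto simp: functigraph_def)
  have RL: "(Inr j, Inl u) \<in> parcs ?H \<longleftrightarrow> u \<in> pverts G \<and> f u = j" for u j
    by (auto simp: functigraph_def)
  have image: "\<exists>u\<in>pverts G - {p}. f u = j" if "j \<in> f ` pverts G" for j
    using that pq by (metis Diff_iff empty_iff image_iff insert_iff)
  have right: "sep (Inr j) (Inr k)" if j: "j \<in> f ` pverts G" "j \<noteq> k" for j k
  proof -
    obtain u where u: "u \<in> pverts G - {p}" "f u = j"
      using image[OF j(1)] by blast
    with j(2) have "(Inr j, Inl u) \<in> parcs ?H" "(Inr k, Inl u) \<notin> parcs ?H"
      by (auto simp: RL)
    with u show ?thesis unfolding sep_def by blast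
  qed
  have mixed: "sep (Inl p) (Inr k)" if k: "k \<in> insert z (f ` pverts G)" for k
  proof (cases "{u \<in> pverts G. f u = k} - {p} = {u. (p, u) \<in> parcs G}")
    case True
    then obtain l where l: "l \<in> pverts G - f ` pverts G - {z}" "(k, l) \<in> parcs G"
      using fibre by blast
    \<comment> \<open>The only neighbour of \<open>Inl p\<close> in the second copy is the image
      vertex \<open>f p\<close>, which cannot be \<open>l\<close>.\<close>
    with pq have "(Inl p, Inr l) \<notin> parcs ?H" "(Inr k, Inr l) \<in> parcs ?H"
      by (auto simp: LR RR)
    with l show ?thesis unfolding sep_def by blast
  next
    case False
    then obtain u where u: "u \<in> {u \<in> pverts G. f u = k} - {p} \<longleftrightarrow> u \<notin> {u. (p, u) \<in> parcs G}"
      by blast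
    \<comment> \<open>Both sets avoid \<open>p\<close>, the second because there are no loops, so
      \<open>Inl u\<close> lies in \<open>?S\<close>.\<close>
    moreover have "u \<in> pverts G - {p}"
      using u G.in_arcsD2 G.no_loops' by auto
    ultimately have "(Inl p, Inl u) \<in> parcs ?H \<longleftrightarrow> (Inr k, Inl u) \<notin> parcs ?H"
      by (auto simp: LL RL)
    with \<open>u \<in> pverts G - {p}\<close> show ?thesis unfolding sep_def by blast
  qed
  have sym: "sep x y" if "sep y x" for x y
    using that unfolding sep_def by blast
  show ?thesis
  proof (rule H.resolving_setI_adjacency)
    show "?S \<subseteq> pverts ?H" by (auto simp: functigraph_def)
    have V: "pverts ?H - ?S \<subseteq> insert (Inl p) (Inr ` insert z (f ` pverts G))"
      by (auto simp: functigraph_def)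
    fix x y assume xy: "x \<in> pverts ?H - ?S" "y \<in> pverts ?H - ?S" "x \<noteq> y"
    \<comment> \<open>The only non-image vertex left out is \<open>z\<close>, so of two distinct
      second-copy vertices outside \<open>?S\<close> one is an image vertex.\<close>
    then consider k where "x = Inl p" "y = Inr k" "k \<in> insert z (f ` pverts G)"
      | k where "x = Inr k" "y = Inl p" "k \<in> insert z (f ` pverts G)"
      | j k where "x = Inr j" "y = Inr k" "j \<in> f ` pverts G" "j \<noteq> k"
      | j k where "x = Inr j" "y = Inr k" "k \<in> f ` pverts G" "j \<noteq> k"
      using subsetD[OF V xy(1)] subsetD[OF V xy(2)] by blast
    then have "sep x y"
    proof cases
      case 1
      with mixed show ?thesis by simp
    next
      case 2
      with mixed[of k, THEN sym] show ?thesis by simp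
    next
      case 3
      with right show ?thesis by simp
    next
      case 4
      with right[of k j, THEN sym] show ?thesis by simp
    qed
    then show "\<exists>s\<in>?S. (x, s) \<in> parcs ?H \<longleftrightarrow> (y, s) \<notin> parcs ?H"
      unfolding sep_def .
  qed
qed

lemma card_functigraph_resolving_set:
  assumes "finite V" "f ` V \<subseteq> V" "p \<in> V" "z \<in> V - f ` V"
  shows "card (Inl ` (V - {p}) \<union> Inr ` (V - f ` V - {z})) = 2 * (card V - 1) - card (f ` V)"
proof -
  have "card (V - f ` V - {z}) = card V - card (f ` V) - 1"
    using assms by (simp add: card_Diff_subset finite_subset)
  \<comment> \<open>The strict inequality, witnessed by \<open>z\<close>, keeps the natural
    subtraction from truncating.\<close>
  moreover have "card (f ` V) < card V"
    using assms by (intro psubset_card_mono) auto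
  moreover have "card (Inl ` (V - {p}) \<union> Inr ` (V - f ` V - {z})) =
      card (V - {p}) + card (V - f ` V - {z})"
    using assms by (subst card_Un_disjoint) (auto simp: card_image)
  ultimately show ?thesis using assms by simp
qed

section \<open>Choosing \<open>p\<close> and \<open>z\<close> on a cycle\<close>

text \<open>The predecessor is written with \<open>n - 1\<close> added, since subtracting 1 would
  truncate at \<open>p = 0\<close>.\<close>

lemma cycle_graph_nbrs:
  assumes "p < n"
  shows "{u. (p, u) \<in> parcs (cycle_graph n)} = {(p + 1) mod n, (p + (n - 1)) mod n}"
proof -
  have "p = (u + 1) mod n \<longleftrightarrow> u = (p + (n - 1)) mod n" if "u < n" for u
  proof (cases "p = 0")
    case True
    with assms that show ?thesis by (auto simp: mod_Suc)
  next
    case False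
    with assms have "p + (n - 1) = (p - 1) + n" by simp
    then have "(p + (n - 1)) mod n = ((p - 1) + n) mod n" by (rule arg_cong)
    also have "\<dots> = p - 1" using assms by simp
    finally have "(p + (n - 1)) mod n = p - 1" .
    with False assms that show ?thesis by (auto simp: mod_Suc)
  qed
  with assms show ?thesis by (auto simp: cycle_graph_def)
qed

text \<open>
  The hypothesis at \<open>p = i + 1\<close> gives \<open>f i = f (i + 2)\<close>, so \<open>i + 2\<close> again shares its image and the
  hypothesis propagates around the cycle: \<open>f\<close> is invariant under the shift by 2. A fibre that is
  \<open>{p - 1, p + 1}\<close> up to \<open>p\<close> then leaves no room unless \<open>n = 4\<close>.
\<close>

lemma cycle_good_vertex:
  fixes n :: nat
  assumes n: "n \<ge> 3" and inj: "\<not> inj_on f {..<n}" and card: "card (f ` {..<n}) > 1"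
    and bad: "\<And>p. p < n \<Longrightarrow> \<exists>q<n. p \<noteq> q \<and> f p = f q \<Longrightarrow>
      \<exists>j. {u. u < n \<and> f u = j} - {p} = {(p + 1) mod n, (p + (n - 1)) mod n}"
  shows "n = 4 \<and> f 0 = f 2 \<and> f 1 = f 3 \<and> f 0 \<noteq> f 1"
proof -
  \<comment> \<open>The periodic extension of \<open>f\<close> to all naturals spares reductions
    modulo \<open>n\<close> in the shifts.\<close>
  define g where "g i = f (i mod n)" for i
  define nonunique where "nonunique i \<longleftrightarrow> (\<exists>q<n. i mod n \<noteq> q \<and> g i = f q)" for i
  have shift: "g i = g (i + 2)" if "nonunique (i + 1)" for i
  proof -
    have "(i + 1) mod n < n" using n by simp
    with bad[of "(i + 1) mod n"] that obtain j
      where j: "{u. u < n \<and> f u = j} - {(i + 1) mod n} =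
        {((i + 1) mod n + 1) mod n, ((i + 1) mod n + (n - 1)) mod n}"
      unfolding nonunique_def g_def by blast
    have "((i + 1) mod n + 1) mod n = (i + 2) mod n" by (simp add: mod_simps)
    moreover have "((i + 1) mod n + (n - 1)) mod n = i mod n"
    proof -
      have "((i + 1) mod n + (n - 1)) mod n = ((i + 1) + (n - 1)) mod n"
        by (rule mod_add_left_eq)
      also have "(i + 1) + (n - 1) = i + n" using n by linarith
      finally show ?thesis by simp
    qed
    ultimately have "{u. u < n \<and> f u = j} - {(i + 1) mod n} = {(i + 2) mod n, i mod n}"
      using j by simp
    then have "f ((i + 2) mod n) = j" "f (i mod n) = j" by blast+
    then show ?thesis by (simp add: g_def)
  qed
  have neq2: "i mod n \<noteq> (i + 2) mod n" for i
  proof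
    assume "i mod n = (i + 2) mod n"
    then have "n dvd i + 2 - i" using mod_eq_dvd_iff_nat[of i "i + 2" n] by simp
    with n show False by (simp add: nat_dvd_not_less)
  qed
  have step: "nonunique (i + 2)" if "nonunique (i + 1)" for i
    unfolding nonunique_def
    using shift[OF that] neq2[of i] n by (intro exI[of _ "i mod n"]) (simp add: g_def)
  obtain a where a: "a < n" "nonunique a"
    using inj n unfolding inj_on_def nonunique_def g_def by fastforce
  \<comment> \<open>Starting at \<open>a + n\<close> rather than \<open>a\<close> ensures that the
    predecessor required by \<open>step\<close> exists.\<close>
  have all_from: "nonunique (a + n + k)" for k
  proof (induction k)
    case 0
    with a show ?case by (simp add: nonunique_def g_def)
  next
    case (Suc k)
    with step[of "a + n + k - 1"] n show ?case by simp
  qed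
  have all: "nonunique i" for i
  proof -
    \<comment> \<open>Adding a multiple of \<open>n\<close> that is at least \<open>a + n\<close>
      moves \<open>i\<close> into the range of \<open>all_from\<close> without changing its
      residue.\<close>
    have "a + n \<le> n * (a + n)" using n by (cases n) simp_all
    then obtain k where "n * (a + n) = a + n + k" using le_Suc_ex by blast
    with all_from[of "i + k"] have "nonunique (i + n * (a + n))"
      by (simp add: ac_simps)
    then show ?thesis by (simp add: nonunique_def g_def)
  qed
  have period: "g i = g (i + 2)" for i using shift all by blast
  have per_n: "g (i + n) = g i" for i by (simp add: g_def)
  have ne: "\<not> (\<forall>i. g i = g 0)"
  proof
    assume "\<forall>i. g i = g 0"
    then have "f u = g 0" if "u < n" for u using that by (metis g_def mod_less)
    then have "f ` {..<n} \<subseteq> {g 0}" by blast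
    from card_mono[OF _ this] card show False by simp
  qed
  have "n \<noteq> 3"
  proof
    assume "n = 3"
    have "g i = g (i + 1)" for i
    proof -
      \<comment> \<open>Two shifts by 2 amount to a shift by 1 modulo 3, which would make
        \<open>f\<close> constant.\<close>
      have "g i = g (i + 2 + 2)" using period[of i] period[of "i + 2"] by (rule trans)
      also have "i + 2 + 2 = i + 1 + n" using \<open>n = 3\<close> by simp
      finally show ?thesis using per_n[of "i + 1"] by (rule trans)
    qed
    then have "g i = g 0" for i by (induction i) (auto simp flip: Suc_eq_plus1)
    with ne show False by blast
  qed
  have "n < 5"
  proof (rule ccontr)
    assume "\<not> n < 5"
    then have n5: "5 \<le> n" by simp
    from all[of 1] n5 have "\<exists>q<n. 1 \<noteq> q \<and> f 1 = f q" by (simp add: nonunique_def g_def)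
    with bad[of 1] n5 obtain j where
      "{u. u < n \<and> f u = j} - {1} = {(1 + 1) mod n, (1 + (n - 1)) mod n}" by auto
    then have j: "{u. u < n \<and> f u = j} - {1} = {2, 0}" using n5 by (simp add: numeral_2_eq_2)
    then have "f 2 = j" by blast
    \<comment> \<open>As \<open>4 < n\<close>, the vertex 4 is a further element of a fibre that
      should be only \<open>{0, 2}\<close> up to 1.\<close>
    with period[of 2] n5 have "f 4 = j" by (simp add: g_def)
    with n5 have "4 \<in> {u. u < n \<and> f u = j} - {1}" by simp
    then show False unfolding j by simp
  qed
  with n \<open>n \<noteq> 3\<close> have "n = 4" by simp
  moreover have "g 0 \<noteq> g 1"
  proof
    assume "g 0 = g 1"
    have "g i = g 0 \<and> g (Suc i) = g 0" for i
    proof (induction i)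
      case 0
      with \<open>g 0 = g 1\<close> show ?case by simp
    next
      case (Suc i)
      with period[of i] show ?case by simp
    qed
    with ne show False by blast
  qed
  moreover have "g 0 = g 2" using period[of 0] by (simp only: add_0)
  moreover have "g 1 = g 3"
  proof -
    have "(1 :: nat) + 2 = 3" by simp
    with period[of 1] show ?thesis by (simp only:)
  qed
  ultimately show ?thesis by (simp add: g_def)
qed

text \<open>With \<open>{j, k}\<close> as the image, \<open>k\<close> is at most one of the two
  neighbours of \<open>j\<close>; another one serves as \<open>l\<close>, and the vertex that
  remains is \<open>z\<close>.\<close>

lemma four_cycle_choice:
  fixes j k :: nat
  assumes "j < 4" "k < 4" "j \<noteq> k"
  shows "\<exists>z<4. z \<notin> {j, k} \<and> (\<exists>l<4. l \<notin> {j, k, z} \<and> (j, l) \<in> parcs (cycle_graph 4))"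
proof -
  define z l where "z = (if k = (j + 2) mod 4 then (j + 3) mod 4 else (j + 2) mod 4)"
    and "l = (if k = (j + 1) mod 4 then (j + 3) mod 4 else (j + 1) mod 4)"
  have "j = 0 \<or> j = 1 \<or> j = 2 \<or> j = 3" "k = 0 \<or> k = 1 \<or> k = 2 \<or> k = 3"
    using assms by linarith+
  with assms(3) have "z < 4" "z \<notin> {j, k}" "l < 4" "l \<notin> {j, k, z}" "(j, l) \<in> parcs (cycle_graph 4)"
    unfolding cycle_graph_def z_def l_def by (elim disjE; simp)+
  then show ?thesis by blast
qed

text \<open>If the neighbourhood of some admissible \<open>p\<close> is no fibre up to
  \<open>p\<close>, the last condition is vacuous and any non-image \<open>z\<close> works.
  Otherwise \<open>n = 4\<close>, and \<open>p = 0\<close>, \<open>q = 2\<close> work with a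
  \<open>z\<close> that spares a neighbour of \<open>f 1\<close>.\<close>

lemma cycle_resolving_choice:
  assumes n: "n \<ge> 3" and f: "f ` {..<n} \<subseteq> {..<n}"
    and card: "1 < card (f ` {..<n})" "card (f ` {..<n}) < n"
  shows "\<exists>p<n. \<exists>q<n. \<exists>z<n. p \<noteq> q \<and> f p = f q \<and> z \<notin> f ` {..<n} \<and>
    (\<forall>j. {u \<in> {..<n}. f u = j} - {p} = {u. (p, u) \<in> parcs (cycle_graph n)} \<longrightarrow>
      (\<exists>k\<in>{..<n} - f ` {..<n} - {z}. (j, k) \<in> parcs (cycle_graph n)))"
proof -
  have inj: "\<not> inj_on f {..<n}"
    using card(2) card_image by fastforce
  obtain z0 where z0: "z0 < n" "z0 \<notin> f ` {..<n}"
    using card(2) f by (metis card_lessThan lessThan_iff nat_neq_iff subsetI subset_antisym)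
  define nbr_fibre where
    "nbr_fibre p j \<longleftrightarrow> {u \<in> {..<n}. f u = j} - {p} = {u. (p, u) \<in> parcs (cycle_graph n)}" for p j
  show ?thesis
    unfolding nbr_fibre_def[symmetric]
  proof (cases "\<exists>p<n. (\<exists>q<n. p \<noteq> q \<and> f p = f q) \<and> (\<forall>j. \<not> nbr_fibre p j)")
    case True
    then obtain p q where "p < n" "q < n" "p \<noteq> q" "f p = f q"
      and "\<And>j. \<not> nbr_fibre p j" by blast
    with z0 show "\<exists>p<n. \<exists>q<n. \<exists>z<n. p \<noteq> q \<and> f p = f q \<and> z \<notin> f ` {..<n} \<and>
      (\<forall>j. nbr_fibre p j \<longrightarrow>
        (\<exists>k\<in>{..<n} - f ` {..<n} - {z}. (j, k) \<in> parcs (cycle_graph n)))"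
      by (intro exI[of _ p] exI[of _ q] exI[of _ z0] conjI allI impI) simp_all
  next
    case False
    then have bad: "\<exists>j. {u. u < n \<and> f u = j} - {p} = {(p + 1) mod n, (p + (n - 1)) mod n}"
      if "p < n" "\<exists>q<n. p \<noteq> q \<and> f p = f q" for p
    proof -
      from False that obtain j where "nbr_fibre p j" by blast
      then show ?thesis unfolding nbr_fibre_def using cycle_graph_nbrs[OF \<open>p < n\<close>] by auto
    qed
    have C4: "n = 4" "f 0 = f 2" "f 1 = f 3" "f 0 \<noteq> f 1"
      using cycle_good_vertex[OF n inj card(1) bad] by blast+
    have im: "f ` {..<n} = {f 1, f 0}"
      using C4 by (auto simp: numeral_eq_Suc lessThan_Suc)
    from f im C4(1) have "f 1 < 4" "f 0 < 4" by auto
    with four_cycle_choice[of "f 1" "f 0"] C4(4) obtain z k where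
      z: "z < 4" "z \<notin> {f 1, f 0}" and
      k: "k < 4" "k \<notin> {f 1, f 0, z}" "(f 1, k) \<in> parcs (cycle_graph 4)" by metis
    \<comment> \<open>Since 1 is a neighbour of 0, only the fibre of \<open>f 1\<close> can match
      the neighbourhood of 0.\<close>
    have "j = f 1" if "nbr_fibre 0 j" for j
    proof -
      from that have "1 \<in> {u \<in> {..<n}. f u = j} - {0}"
        unfolding nbr_fibre_def using C4(1) by (simp add: cycle_graph_nbrs)
      then show ?thesis by simp
    qed
    moreover have "k \<in> {..<n} - f ` {..<n} - {z}" "(f 1, k) \<in> parcs (cycle_graph n)"
      unfolding im using k C4(1) by simp_all
    ultimately have "\<exists>k\<in>{..<n} - f ` {..<n} - {z}. (j, k) \<in> parcs (cycle_graph n)"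
      if "nbr_fibre 0 j" for j
      using that by blast
    moreover have "0 < n" "2 < n" "z < n" "(0 :: nat) \<noteq> 2" "z \<notin> f ` {..<n}"
      unfolding im using z C4(1) by simp_all
    ultimately show "\<exists>p<n. \<exists>q<n. \<exists>z<n. p \<noteq> q \<and> f p = f q \<and> z \<notin> f ` {..<n} \<and>
      (\<forall>j. nbr_fibre p j \<longrightarrow>
        (\<exists>k\<in>{..<n} - f ` {..<n} - {z}. (j, k) \<in> parcs (cycle_graph n)))"
      using C4(2) by (intro exI[of _ 0] exI[of _ 2] exI[of _ z] conjI allI impI) simp_all
  qed
qed

section \<open>The two bounds\<close>

lemma cycle_two_nbrs:
  assumes "n \<ge> 3" "i < n"
  shows "\<exists>x y. x \<noteq> i \<and> y \<noteq> i \<and> x \<noteq> y \<and>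
    (x, i) \<in> parcs (cycle_graph n) \<and> (y, i) \<in> parcs (cycle_graph n)"
proof -
  let ?x = "if Suc i = n then 0 else Suc i" and ?y = "if i = 0 then n - 1 else i - 1"
  have "(?x, i) \<in> parcs (cycle_graph n)" "(?y, i) \<in> parcs (cycle_graph n)"
    using assms by (auto simp: cycle_graph_def)
  moreover have "?x \<noteq> i" "?y \<noteq> i" "?x \<noteq> ?y" using assms by auto
  ultimately show ?thesis by blast
qed

theorem theorem4p6:
  fixes n s :: nat and f :: "nat \<Rightarrow> nat"
  assumes "n \<ge> 3"
    and "f ` pverts (cycle_graph n) \<subseteq> pverts (cycle_graph n)"
    and "card (f ` pverts (cycle_graph n)) = s"
    and "1 < s" and "s < n"
  shows "2 \<le> metric_dim (functigraph (cycle_graph n) f) \<and>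
    metric_dim (functigraph (cycle_graph n) f) \<le> 2 * (n - 1) - s"
proof -
  let ?G = "cycle_graph n"
  let ?H = "functigraph ?G f"
  have V: "pverts ?G = {..<n}" by (simp add: cycle_graph_def)
  interpret H: pair_graph ?H
    using assms by (intro pair_graph_functigraph pair_graph_cycle_graph)
  obtain p q z where pqz: "p < n" "q < n" "z < n" "p \<noteq> q" "f p = f q" "z \<notin> f ` {..<n}"
    and fibre: "\<And>j. {u \<in> {..<n}. f u = j} - {p} = {u. (p, u) \<in> parcs ?G} \<Longrightarrow>
      \<exists>k\<in>{..<n} - f ` {..<n} - {z}. (j, k) \<in> parcs ?G"
  proof -
    have "f ` {..<n} \<subseteq> {..<n}" "1 < card (f ` {..<n})" "card (f ` {..<n}) < n"
      using assms unfolding V by simp_all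
    from cycle_resolving_choice[OF \<open>n \<ge> 3\<close> this] that show thesis by blast
  qed
  define S :: "(nat + nat) set"
    where "S = Inl ` ({..<n} - {p}) \<union> Inr ` ({..<n} - f ` {..<n} - {z})"
  have "finite S" by (simp add: S_def)
  have "resolving_set ?H S"
    using resolving_set_functigraph[OF pair_graph_cycle_graph[OF \<open>n \<ge> 3\<close>] assms(2), of p q z]
      pqz fibre unfolding V S_def by blast
  have "card S = 2 * (n - 1) - s"
    unfolding S_def using card_functigraph_resolving_set[of "{..<n}" f p z] assms pqz
    by (simp add: V)
  let ?P = "\<lambda>k. \<exists>S. finite S \<and> resolving_set ?H S \<and> card S = k"
  have witness: "?P (2 * (n - 1) - s)"
    using \<open>finite S\<close> \<open>resolving_set ?H S\<close> \<open>card S = _\<close> by blast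
  have two_nbrs: "\<exists>x y. x \<noteq> v \<and> y \<noteq> v \<and> x \<noteq> y \<and> (x, v) \<in> parcs ?H \<and> (y, v) \<in> parcs ?H"
    if "v \<in> pverts ?H" for v
  proof -
    \<comment> \<open>Two neighbours already exist within the copy containing \<open>v\<close>, so
      the embedding \<open>c\<close> treats both copies at once.\<close>
    from that obtain c i where c: "c = Inl \<or> c = Inr" "v = c i" "i < n"
      by (auto simp: functigraph_def V)
    obtain x y where "x \<noteq> i" "y \<noteq> i" "x \<noteq> y" "(x, i) \<in> parcs ?G" "(y, i) \<in> parcs ?G"
      using cycle_two_nbrs[OF \<open>n \<ge> 3\<close> \<open>i < n\<close>] by blast
    then have "c x \<noteq> v" "c y \<noteq> v" "c x \<noteq> c y" "(c x, v) \<in> parcs ?H" "(c y, v) \<in> parcs ?H"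
      using c(1,2) by (auto simp: functigraph_def)
    then show ?thesis by blast
  qed
  have "pverts ?H \<noteq> {}" using \<open>p < n\<close> by (auto simp: functigraph_def V)
  then have "2 \<le> k" if "?P k" for k
    using that H.two_le_card_resolving_set two_nbrs by blast
  \<comment> \<open>The set \<open>S\<close> also shows that the minimum is attained, so the lower
    bound applies to it.\<close>
  moreover have "?P (metric_dim ?H)"
    unfolding metric_dim_def using witness by (rule LeastI)
  moreover have "metric_dim ?H \<le> 2 * (n - 1) - s"
    unfolding metric_dim_def using witness by (rule Least_le)
  ultimately show ?thesis by blast
qed

end
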